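(* Up to isomorphism, the symmetric group $S_3$ is the unique finite group $G$ such that $G$ is not a $p$-group (for any prime $p$) and $|C(G)| = |G| - 1$, where $C(G)$ denotes the set of cyclic subgroups of $G$.
   Context: For a finite group $G$, $C(G)$ is the poset (set) of all cyclic subgroups of $G$, including the trivial subgroup. $S_3$ denotes the symmetric group on three letters. *)

theory Defs
  imports
    "HOL-Algebra.Elementary_Groups"
    "HOL-Algebra.Sym_Groups"
    "HOL-Computational_Algebra.Primes"
begin

definition cyclic_subgroups :: "('a, 'b) monoid_scheme \<Rightarrow> 'a set set" where
  "cyclic_subgroups G = {H. subgroup H G \<and> cyclic_group (G\<lparr>carrier := H\<rparr>)}"

text \<open>
  The notion for finite groups: the order is a power of \<open>p\<close>. The exponent may be \<open>0\<close>, so the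
  trivial group is a \<open>p\<close>-group for every prime \<open>p\<close>.
\<close>
definition finite_p_group :: "nat \<Rightarrow> ('a, 'b) monoid_scheme \<Rightarrow> bool" where
  "finite_p_group p G \<longleftrightarrow> prime p \<and> group G \<and> (\<exists>k. order G = p ^ k)"

end

theory Submission
  imports Defs "HOL-Algebra.Multiplicative_Group" "HOL-Algebra.Sylow"
begin

text \<open>
  The map \<open>g \<mapsto> \<langle>g\<rangle>\<close> from \<open>G\<close> onto its cyclic subgroups has exactly one collision when there is one
  cyclic subgroup fewer than there are elements. If \<open>|G|\<close> is not a power of two, Cauchy's theorem
  gives \<open>x\<close> of odd order \<open>> 1\<close>, which generates the same subgroup as both \<open>x\<^sup>2\<close> and \<open>x\<^sup>-\<^sup>1\<close>;
  hence \<open>x\<^sup>2 = x\<^sup>-\<^sup>1\<close>, and every element other than \<open>x, x\<^sup>-\<^sup>1\<close> is its own inverse. An element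
  \<open>t\<close> outside \<open>\<langle>x\<rangle>\<close> inverts \<open>x\<close>, a product of two such elements commutes with \<open>x\<close> and so
  lies in \<open>\<langle>x\<rangle>\<close>, and \<open>G\<close> is dihedral of order six.
\<close>

text \<open>If \<open>f u = f v\<close> with \<open>u\<close> and \<open>v\<close> distinct,
  deleting \<open>v\<close> keeps the image, so by counting \<open>f\<close> is injective on the
  rest. Any other collision must therefore use the deleted point; deleting \<open>a\<close> and
  \<open>b\<close> in turn identifies the pair.\<close>

lemma unique_collision:
  assumes "finite A" "card A = Suc (card (f ` A))"
    and ab: "a \<in> A" "b \<in> A" "a \<noteq> b" "f a = f b"
    and cd: "c \<in> A" "d \<in> A" "c \<noteq> d" "f c = f d"
  shows "{c, d} = {a, b}"
proof -
  have inj: "inj_on f (A - {v})" if "v \<in> A" "u \<in> A" "u \<noteq> v" "f u = f v" for u v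
  proof -
    have "f v \<in> f ` (A - {v})" using that by (metis Diff_iff imageI singletonD)
    then have "f ` (A - {v}) = f ` insert v (A - {v})"
      by (simp add: insert_absorb del: insert_Diff_single)
    also have "insert v (A - {v}) = A" using that by (simp add: insert_absorb)
    finally show ?thesis using assms(1,2) that by (intro eq_card_imp_inj_on) simp_all
  qed
  have "a \<in> {c, d}"
    using inj_onD[OF inj[of a b], of c d] ab cd by (metis Diff_iff insertI1 insertI2 singletonD)
  moreover have "b \<in> {c, d}"
    using inj_onD[OF inj[of b a], of c d] ab cd by (metis Diff_iff insertI1 insertI2 singletonD)
  ultimately show ?thesis using ab(3) by auto
qed

section \<open>Cyclic subgroups as values of a map on elements, and elements of odd order\<close>

context group
begin

text \<open>This form turns the count of cyclic subgroups into the size of an image, to which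
  \<open>unique_collision\<close> applies.\<close>

lemma cyclic_subgroups_eq_generate:
  "cyclic_subgroups G = (\<lambda>g. generate G {g}) ` carrier G"
proof (intro equalityI subsetI)
  fix H
  assume "H \<in> cyclic_subgroups G"
  then have H: "subgroup H G" "cyclic_group (G\<lparr>carrier := H\<rparr>)"
    by (auto simp: cyclic_subgroups_def)
  interpret H: group "G\<lparr>carrier := H\<rparr>" using H(1) by (rule subgroup_imp_group)
  obtain h where h: "h \<in> carrier (G\<lparr>carrier := H\<rparr>)"
    "carrier (G\<lparr>carrier := H\<rparr>) = range (\<lambda>n::int. h [^]\<^bsub>G\<lparr>carrier := H\<rparr>\<^esub> n)"
    using H(2) unfolding H.cyclic_group by blast
  have hH: "h \<in> H" using h(1) by simp
  then have hG: "h \<in> carrier G" using H(1) by (rule subgroup.mem_carrier[rotated])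
  have pow: "(\<lambda>n::int. h [^]\<^bsub>G\<lparr>carrier := H\<rparr>\<^esub> n) = (\<lambda>n. h [^] n)"
    by (rule ext) (rule int_pow_consistent[OF H(1) hH, symmetric])
  have "H = range (\<lambda>n::int. h [^] n)"
    using h(2) unfolding pow by simp
  then have "H = generate G {h}"
    unfolding generate_pow[OF hG] by blast
  then show "H \<in> (\<lambda>g. generate G {g}) ` carrier G" using hG by blast
next
  fix H
  assume "H \<in> (\<lambda>g. generate G {g}) ` carrier G"
  then obtain g where g: "g \<in> carrier G" "H = generate G {g}" by blast
  have "subgroup H G" using g generate_is_subgroup by simp
  moreover have "G\<lparr>carrier := H\<rparr> = subgroup_generated G {g}"
    using g by (simp add: subgroup_generated_def)
  ultimately show "H \<in> cyclic_subgroups G"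
    using cyclic_group_generated[of g] by (simp add: cyclic_subgroups_def)
qed

lemma generate_singleton_eqI:
  assumes "x \<in> carrier G" "y \<in> carrier G" "y \<in> generate G {x}" "x \<in> generate G {y}"
  shows "generate G {x} = generate G {y}"
  using assms generate_subgroup_incl[of "{y}" "generate G {x}"]
    generate_subgroup_incl[of "{x}" "generate G {y}"] generate_is_subgroup[of "{x}"]
    generate_is_subgroup[of "{y}"] by auto

lemma generate_inv:
  assumes "x \<in> carrier G"
  shows "generate G {inv x} = generate G {x}"
  using assms generate.inv[of x "{x}" G] generate.inv[of "inv x" "{inv x}" G]
  by (intro generate_singleton_eqI) auto

lemma generate_involution:
  assumes "g \<in> carrier G" "g \<otimes> g = \<one>"
  shows "generate G {g} = {\<one>, g}"
proof
  have "inv g = g" using assms inv_equality by blast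
  then have "subgroup {\<one>, g} G" using assms by (intro subgroupI) auto
  then show "generate G {g} \<subseteq> {\<one>, g}" by (intro generate_subgroup_incl) auto
qed (auto intro: generate.intros)

lemma nat_pow_mod:
  assumes "g \<in> carrier G" "g [^] (n::nat) = \<one>"
  shows "g [^] (i mod n) = g [^] (i::nat)"
proof -
  have "g [^] i = g [^] (n * (i div n) + i mod n)" by simp
  also have "\<dots> = (g [^] n) [^] (i div n) \<otimes> g [^] (i mod n)"
    using assms(1) by (simp only: nat_pow_mult nat_pow_pow nat_pow_closed)
  also have "\<dots> = g [^] (i mod n)" using assms by simp
  finally show ?thesis by (rule sym)
qed

lemma exists_odd_order_element:
  assumes "finite (carrier G)" "\<not> finite_p_group 2 G"
  obtains x k where "x \<in> carrier G" "x \<noteq> \<one>" "x [^] (2 * k + 1 :: nat) = \<one>"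
proof -
  have "order G \<noteq> 0" using assms(1) order_gt_0_iff_finite by simp
  then obtain a m where m: "order G = 2 ^ a * m" "\<not> 2 dvd m"
    using multiplicity_decompose'[of "order G" 2] by (metis odd_one)
  have "m \<noteq> 1" using assms(2) m is_group by (auto simp: finite_p_group_def)
  then obtain p where p: "prime p" "p dvd m" using prime_factor_nat by blast
  then have "odd p" using m(2) dvd_trans by blast
  \<comment> \<open>Cauchy's theorem as Sylow's theorem with exponent 1: the cofactor
    \<open>r\<close> may still be divisible by \<open>p\<close>.\<close>
  have "p ^ 1 dvd order G" using m(1) p(2) by simp
  then obtain r where "order G = p ^ 1 * r" by (elim dvdE)
  then obtain H where H: "subgroup H G" "card H = p"
    using sylow_thm[OF p(1) is_group _ assms(1), of 1] by auto
  have "card H > 1" using H p prime_gt_1_nat by simp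
  then have "\<not> H \<subseteq> {\<one>}" using card_mono[of "{\<one>}" H] by auto
  then obtain x where x: "x \<in> H" "x \<noteq> \<one>" by blast
  interpret H: group "G\<lparr>carrier := H\<rparr>" using H(1) by (rule subgroup_imp_group)
  have order_H: "order (G\<lparr>carrier := H\<rparr>) = p" using H(2) by (simp add: order_def)
  have "x [^] p = x [^]\<^bsub>G\<lparr>carrier := H\<rparr>\<^esub> order (G\<lparr>carrier := H\<rparr>)"
    unfolding order_H by (rule nat_pow_consistent)
  also have "\<dots> = \<one>" using H.pow_order_eq_1[of x] x(1) by simp
  finally have "x [^] p = \<one>" .
  moreover obtain k where "p = 2 * k + 1" using \<open>odd p\<close> by (elim oddE)
  ultimately have "x [^] (2 * k + 1) = \<one>" by simp
  moreover have "x \<in> carrier G" using H(1) x(1) by (rule subgroup.mem_carrier)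
  ultimately show thesis using that x(2) by simp
qed

end

section \<open>Normal forms under the relations of the dihedral group of order six\<close>

locale S3_relations = group +
  fixes x t
  assumes x [simp]: "x \<in> carrier G" "x \<noteq> \<one>"
    and t [simp]: "t \<in> carrier G" "t \<noteq> \<one>"
    and xxx: "x \<otimes> (x \<otimes> x) = \<one>"
    and tt [simp]: "t \<otimes> t = \<one>"
    and tx: "t \<otimes> x = x \<otimes> (x \<otimes> t)"
begin

definition elems where
  "elems = {\<one>, x, x \<otimes> x, t, x \<otimes> t, x \<otimes> (x \<otimes> t)}"

text \<open>The \<open>_left\<close> variants apply each relation in front of a remaining factor.
  With \<open>m_assoc\<close> they move every \<open>t\<close> to the right of every
  \<open>x\<close> in right-nested products.\<close>

lemma xxx_left: "y \<in> carrier G \<Longrightarrow> x \<otimes> (x \<otimes> (x \<otimes> y)) = y"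
  by (metis l_one m_assoc m_closed x(1) xxx)

lemma tt_left: "y \<in> carrier G \<Longrightarrow> t \<otimes> (t \<otimes> y) = y"
  by (metis l_one m_assoc t(1) tt)

lemma tx_left: "y \<in> carrier G \<Longrightarrow> t \<otimes> (x \<otimes> y) = x \<otimes> (x \<otimes> (t \<otimes> y))"
  by (metis m_assoc m_closed t(1) tx x(1))

lemmas word_simps = m_assoc xxx xxx_left tt_left tx tx_left

lemma xx_neq_one: "x \<otimes> x \<noteq> \<one>"
  using xxx by auto

lemma t_neq_x: "t \<noteq> x"
  using tt xx_neq_one by metis

lemma t_neq_xx: "t \<noteq> x \<otimes> x"
proof
  assume "t = x \<otimes> x"
  then have "x \<otimes> x \<otimes> (x \<otimes> x) = \<one>" using tt by metis
  then show False by (simp add: word_simps)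
qed

lemma xt_neq_one: "x \<otimes> t \<noteq> \<one>"
  using right_cancel[of t x t] t_neq_x by auto

lemma xxt_neq_one: "x \<otimes> (x \<otimes> t) \<noteq> \<one>"
  using right_cancel[of t "x \<otimes> x" t] t_neq_xx by (auto simp: m_assoc)

lemma xxt_neq_t: "x \<otimes> (x \<otimes> t) \<noteq> t"
  using right_cancel[of t "x \<otimes> x" \<one>] xx_neq_one by (auto simp: m_assoc)

lemmas distinct_words =
  xx_neq_one t_neq_x t_neq_xx xt_neq_one xxt_neq_one xxt_neq_t x(2) t(2)

lemma card_elems: "card elems = 6"
  unfolding elems_def by (simp add: distinct_words distinct_words[symmetric])

lemma elems_subset: "elems \<subseteq> carrier G"
  by (auto simp: elems_def)

text \<open>The exponents stay unreduced, so that products of words have a closed formula without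
  case distinctions.\<close>

definition word :: "nat \<times> nat \<Rightarrow> 'a" where
  "word = (\<lambda>(i, j). x [^] i \<otimes> t [^] j)"

abbreviation (input) indices :: "(nat \<times> nat) set" where
  "indices \<equiv> {..<3} \<times> {..<2}"

text \<open>Each \<open>t\<close> moved past a power of \<open>x\<close> doubles its exponent.
  Doubling is negation modulo 3 and keeps exponents natural.\<close>

lemma t_pow_x_pow: "t [^] (j::nat) \<otimes> x [^] (k::nat) = x [^] (2 ^ j * k) \<otimes> t [^] j"
proof (induction j arbitrary: k)
  case (Suc j)
  have *: "t \<otimes> x [^] k = x [^] (2 * k) \<otimes> t" for k :: nat
  proof (induction k)
    case (Suc k)
    have "t \<otimes> x [^] Suc k = x [^] (2 * k) \<otimes> (t \<otimes> x)"
      using Suc by (simp flip: m_assoc)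
    also have "\<dots> = x [^] (2 * Suc k) \<otimes> t"
      by (simp add: tx m_assoc)
    finally show ?case .
  qed simp
  have "t [^] Suc j \<otimes> x [^] k = t [^] j \<otimes> x [^] (2 * k) \<otimes> t"
    by (simp add: m_assoc *)
  also have "\<dots> = x [^] (2 ^ Suc j * k) \<otimes> t [^] Suc j"
    by (simp add: Suc m_assoc ac_simps)
  finally show ?case .
qed simp

text \<open>The resulting exponents do not depend on the group, which makes the comparison of two
  such groups in \<open>S3_like_iso\<close> a homomorphism.\<close>

lemma word_mult: "word (i, j) \<otimes> word (k, l) = word (i + 2 ^ j * k, j + l)"
proof -
  have "word (i, j) \<otimes> word (k, l) = x [^] i \<otimes> (t [^] j \<otimes> x [^] k) \<otimes> t [^] l"
    by (simp add: word_def m_assoc)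
  also have "\<dots> = word (i + 2 ^ j * k, j + l)"
    unfolding t_pow_x_pow by (simp add: word_def m_assoc flip: nat_pow_mult)
  finally show ?thesis .
qed

lemma word_mod: "word (i mod 3, j mod 2) = word (i, j)"
proof -
  have "x [^] (3::nat) = \<one>" "t [^] (2::nat) = \<one>"
    by (simp_all add: numeral_eq_Suc word_simps)
  then show ?thesis by (simp add: word_def nat_pow_mod)
qed

lemma word_image: "word ` indices = elems"
  by (auto simp: word_def elems_def numeral_eq_Suc lessThan_Suc m_assoc image_iff)

lemma inj_on_word: "inj_on word indices"
  by (rule eq_card_imp_inj_on) (simp_all add: word_image card_elems)

end

section \<open>Groups consisting of the six words: cyclic subgroups and uniqueness\<close>

locale S3_like = S3_relations +
  assumes carrier_subset: "carrier G \<subseteq> elems"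
begin

lemma carrier_eq: "carrier G = elems"
  using carrier_subset elems_subset by blast

text \<open>Only \<open>x\<close> and its square share a generated subgroup; the three involutions
  and the identity each generate their own.\<close>

lemma card_cyclic_subgroups: "card (cyclic_subgroups G) = order G - 1"
proof -
  let ?X = "generate G {x}"
  have "x \<in> ?X" by (simp add: generate.incl)
  have "x \<otimes> x \<in> ?X" by (simp add: generate.incl generate.eng)
  \<comment> \<open>The square of \<open>x \<otimes> x\<close> is the fourth power of
    \<open>x\<close>, hence \<open>x\<close> itself.\<close>
  moreover have "x \<otimes> x \<otimes> (x \<otimes> x) \<in> generate G {x \<otimes> x}"
    by (intro generate.eng generate.incl) auto
  then have "x \<in> generate G {x \<otimes> x}" by (simp add: word_simps)
  ultimately have xx: "generate G {x \<otimes> x} = ?X"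
    by (intro generate_singleton_eqI[symmetric]) auto
  note neq = distinct_words distinct_words[symmetric]
  have "cyclic_subgroups G =
      {{\<one>}, ?X, {\<one>, t}, {\<one>, x \<otimes> t}, {\<one>, x \<otimes> (x \<otimes> t)}}"
    unfolding cyclic_subgroups_eq_generate carrier_eq elems_def
    by (simp add: xx generate_involution word_simps)
  moreover have "?X \<noteq> {\<one>}" "?X \<noteq> {\<one>, t}" "?X \<noteq> {\<one>, x \<otimes> t}"
    "?X \<noteq> {\<one>, x \<otimes> (x \<otimes> t)}"
    using \<open>x \<in> ?X\<close> neq by auto
  ultimately have "card (cyclic_subgroups G) = 5"
    by (simp add: doubleton_eq_iff neq)
  then show ?thesis by (simp add: order_def carrier_eq card_elems)
qed

end

lemma S3_like_iso:
  assumes "S3_like G x t" "S3_like H y s"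
  shows "G \<cong> H"
proof -
  interpret G: S3_like G x t by fact
  interpret H: S3_like H y s by fact
  let ?I = "{..<3::nat} \<times> {..<2::nat}"
  define h where "h = H.word \<circ> inv_into ?I G.word"
  \<comment> \<open>The inverse of \<open>G.word\<close> covers reduced exponents only;
    \<open>word_mod\<close> on both sides extends the equation to all exponents, as
    \<open>word_mult\<close> requires.\<close>
  have h: "h (G.word (i, j)) = H.word (i, j)" for i j
  proof -
    have "h (G.word (i mod 3, j mod 2)) = H.word (i mod 3, j mod 2)"
      by (simp add: h_def inv_into_f_f[OF G.inj_on_word])
    then show ?thesis by (simp add: G.word_mod H.word_mod)
  qed
  have carrier: "carrier G = G.word ` ?I" "carrier H = H.word ` ?I"
    by (simp_all add: G.carrier_eq H.carrier_eq G.word_image H.word_image)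
  have bij: "bij_betw h (carrier G) (carrier H)"
    unfolding h_def carrier
    by (rule bij_betw_trans[OF bij_betw_inv_into])
      (simp_all add: bij_betw_def G.inj_on_word H.inj_on_word)
  have "h \<in> hom G H"
  proof (rule homI)
    fix a b assume "a \<in> carrier G" "b \<in> carrier G"
    then obtain i j k l where "a = G.word (i, j)" "b = G.word (k, l)"
      unfolding carrier by auto
    then show "h (a \<otimes>\<^bsub>G\<^esub> b) = h a \<otimes>\<^bsub>H\<^esub> h b"
      by (simp add: h G.word_mult H.word_mult)
  qed (use bij in \<open>auto simp: bij_betw_def\<close>)
  with bij show ?thesis by (auto simp: is_iso_def iso_def)
qed

text \<open>A 3-cycle and a transposition satisfy the relations; the six words exhaust the group
  because it has six elements.\<close>

lemma S3_like_sym_group: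
  "S3_like (sym_group 3) (transpose 1 2 \<circ> transpose 2 3) (transpose 1 2)"
proof -
  interpret group "sym_group 3" by (rule sym_group_is_group)
  interpret S3_relations "sym_group 3" "transpose 1 2 \<circ> transpose 2 3" "transpose 1 2"
  proof
    show "transpose 1 2 \<circ> transpose 2 3 \<in> carrier (sym_group 3)"
      "transpose 1 2 \<in> carrier (sym_group 3)"
      by (auto simp: sym_group_carrier intro!: permutes_compose permutes_swap_id)
  qed (auto simp: sym_group_mult sym_group_one fun_eq_iff transpose_def)
  show ?thesis
  proof
    have "finite (carrier (sym_group 3))" "card (carrier (sym_group 3)) = 6"
      by (simp_all add: sym_group_card_carrier fact_numeral card_ge_0_finite)
    then show "carrier (sym_group 3) \<subseteq> elems"
      using card_subset_eq[OF _ elems_subset] card_elems by simp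
  qed
qed

section \<open>Recovering the relations from the count of cyclic subgroups\<close>

lemma (in group) S3_like_if_card_cyclic_subgroups:
  assumes fin: "finite (carrier G)" and not_p: "\<And>p. \<not> finite_p_group p G"
    and card: "card (cyclic_subgroups G) = order G - 1"
  obtains x t where "S3_like G x t"
proof -
  obtain x k where x: "x \<in> carrier G" "x \<noteq> \<one>" "x [^] (2 * k + 1 :: nat) = \<one>"
    using exists_odd_order_element[OF fin not_p] by blast
  have not_involution: "x \<otimes> x \<noteq> \<one>"
  proof
    assume "x \<otimes> x = \<one>"
    then have "x [^] (2::nat) = \<one>" using x by (simp add: numeral_eq_Suc)
    then have "x [^] (2 * k + 1) = x" using x by (simp flip: nat_pow_pow)
    then show False using x by simp
  qed
  \<comment> \<open>Positivity of the order rules out truncation in the natural subtraction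
    \<open>order G - 1\<close>.\<close>
  have "order G > 0" using fin order_gt_0_iff_finite by simp
  then have collision: "card (carrier G) = Suc (card ((\<lambda>g. generate G {g}) ` carrier G))"
    using card by (simp add: cyclic_subgroups_eq_generate order_def)
  have x_inv: "x \<noteq> inv x" using not_involution x r_inv by metis
  \<comment> \<open>Odd order makes \<open>x\<close> a power of its square, with exponent
    \<open>k + 1\<close>.\<close>
  have "x = x [^] (2 * k + 1) \<otimes> x" using x by simp
  also have "\<dots> = x [^] (2 * Suc k)" by simp
  also have "\<dots> = (x [^] (2::nat)) [^] Suc k"
    using x(1) by (simp only: nat_pow_pow)
  also have "\<dots> = (x \<otimes> x) [^] int (Suc k)"
    using x(1) by (simp only: int_pow_int) (simp add: numeral_eq_Suc)
  also have "\<dots> \<in> generate G {x \<otimes> x}"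
    unfolding generate_pow[OF m_closed[OF x(1) x(1)]] by blast
  finally have "x \<in> generate G {x \<otimes> x}" .
  moreover have "x \<otimes> x \<in> generate G {x}" by (simp add: generate.incl generate.eng)
  ultimately have "generate G {x} = generate G {x \<otimes> x}"
    using x by (intro generate_singleton_eqI) auto
  then have "{x, x \<otimes> x} = {x, inv x}"
    using x x_inv generate_inv by (intro unique_collision[OF fin collision]) auto
  then have xx: "x \<otimes> x = inv x" using x_inv by (auto simp: doubleton_eq_iff)
  then have xxx: "x \<otimes> (x \<otimes> x) = \<one>" using x by simp
  \<comment> \<open>Otherwise \<open>g\<close> and \<open>inv g\<close> form a collision, which must
    be the one between \<open>x\<close> and \<open>inv x\<close>.\<close>
  have involution: "g \<otimes> g = \<one>" if g: "g \<in> carrier G" "g \<noteq> x" "g \<noteq> x \<otimes> x" for g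
  proof (rule ccontr)
    assume "g \<otimes> g \<noteq> \<one>"
    then have "g \<noteq> inv g" using g r_inv by metis
    then have "{g, inv g} = {x, inv x}"
      using g x x_inv generate_inv by (intro unique_collision[OF fin collision]) auto
    then show False using g xx by (auto simp: doubleton_eq_iff)
  qed
  have inverts: "g \<otimes> x = x \<otimes> (x \<otimes> g)"
    if g: "g \<in> carrier G" "g \<notin> {\<one>, x, x \<otimes> x}" for g
  proof -
    have "g \<otimes> g = \<one>" using involution g by simp
    then have "inv g = g" using g inv_equality by blast
    \<comment> \<open>Cancelling \<open>x\<close> shows that \<open>g \<otimes> x\<close> also
      avoids \<open>x\<close> and its square. It is thus its own inverse, and expanding that inverse
      gives the relation.\<close>
    have "g \<otimes> x \<noteq> x" "g \<otimes> x \<noteq> x \<otimes> x" using g x by auto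
    then have "g \<otimes> x \<otimes> (g \<otimes> x) = \<one>" using involution g x by simp
    then have "g \<otimes> x = inv (g \<otimes> x)" using g x inv_equality by simp
    also have "\<dots> = x \<otimes> (x \<otimes> g)"
      using g(1) x(1) \<open>inv g = g\<close> by (simp add: inv_mult_group m_assoc flip: xx)
    finally show ?thesis .
  qed
  \<comment> \<open>Here the case of a 3-group is excluded; 2-groups were excluded in choosing
    \<open>x\<close>.\<close>
  have "carrier G \<noteq> {\<one>, x, x \<otimes> x}"
  proof
    assume "carrier G = {\<one>, x, x \<otimes> x}"
    moreover have "card {\<one>, x, x \<otimes> x} = 3"
      using x not_involution by (auto simp: card_insert_if)
    ultimately have "order G = 3 ^ 1" by (simp add: order_def)
    moreover have "prime (3::nat)" by simp
    ultimately have "finite_p_group 3 G"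
      unfolding finite_p_group_def using is_group by blast
    then show False using not_p by blast
  qed
  then obtain t where t: "t \<in> carrier G" "t \<notin> {\<one>, x, x \<otimes> x}" using x by blast
  interpret S3_relations G x t
    using x t xxx involution inverts by unfold_locales auto
  have "S3_like G x t"
  proof
    show "carrier G \<subseteq> elems"
    proof
      fix s assume s: "s \<in> carrier G"
      show "s \<in> elems"
      proof (cases "s \<in> {\<one>, x, x \<otimes> x}")
        case False
        \<comment> \<open>Outside this set \<open>t \<otimes> s\<close> would invert
          \<open>x\<close>, yet it commutes with \<open>x\<close> since both factors invert it;
          cancellation would leave \<open>x = \<one>\<close>.\<close>
        have "t \<otimes> s \<in> {\<one>, x, x \<otimes> x}"
        proof (rule ccontr)
          assume "t \<otimes> s \<notin> {\<one>, x, x \<otimes> x}"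
          then have "t \<otimes> s \<otimes> x = x \<otimes> (x \<otimes> (t \<otimes> s))" using inverts s by simp
          moreover have "t \<otimes> s \<otimes> x = x \<otimes> (t \<otimes> s)"
            using s inverts[OF s False] by (simp add: word_simps)
          ultimately show False using s x(2) by simp
        qed
        moreover have "s = t \<otimes> (t \<otimes> s)" using s by (simp add: tt_left)
        ultimately have "s \<in> {t \<otimes> \<one>, t \<otimes> x, t \<otimes> (x \<otimes> x)}" by auto
        then show ?thesis by (auto simp: elems_def word_simps)
      qed (auto simp: elems_def)
    qed
  qed
  then show thesis using that by blast
qed

theorem corollary3:
  shows "(group (sym_group 3) \<and> finite (carrier (sym_group 3)) \<and>
      (\<forall>p. \<not> finite_p_group p (sym_group 3)) \<and>
      card (cyclic_subgroups (sym_group 3)) = order (sym_group 3) - 1) \<and>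
    (\<forall>G :: ('a, 'b) monoid_scheme.
      group G \<and> finite (carrier G) \<and> (\<forall>p. \<not> finite_p_group p G) \<and>
      card (cyclic_subgroups G) = order G - 1 \<longrightarrow> G \<cong> sym_group 3)"
proof (intro conjI allI impI)
  have order: "order (sym_group 3) = 6"
    by (simp add: order_def sym_group_card_carrier fact_numeral)
  show "group (sym_group 3)" by (rule sym_group_is_group)
  show "finite (carrier (sym_group 3))"
    using order by (simp add: order_def card_ge_0_finite)
  show "card (cyclic_subgroups (sym_group 3)) = order (sym_group 3) - 1"
    using S3_like_sym_group by (rule S3_like.card_cyclic_subgroups)
  show "\<not> finite_p_group p (sym_group 3)" for p
  proof
    assume "finite_p_group p (sym_group 3)"
    then obtain k where p: "prime p" "6 = p ^ k"
      unfolding finite_p_group_def order by auto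
    \<comment> \<open>A prime power has a single prime divisor, but 6 has both 2 and 3.\<close>
    have "q = p" if "prime q" "q dvd 6" for q :: nat
      using that p by (metis prime_dvd_power primes_dvd_imp_eq)
    from this[of 2] this[of 3] show False by simp
  qed
next
  fix G :: "('a, 'b) monoid_scheme"
  assume G: "group G \<and> finite (carrier G) \<and> (\<forall>p. \<not> finite_p_group p G) \<and>
    card (cyclic_subgroups G) = order G - 1"
  then interpret group G by blast
  obtain x t where "S3_like G x t"
    using S3_like_if_card_cyclic_subgroups G by blast
  then show "G \<cong> sym_group 3" using S3_like_sym_group by (rule S3_like_iso)
qed

end
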